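(* Every $\mathcal{E}$-Luzin set is in $\mathcal{E}^*$.
   Context: $2^\omega$ is the Cantor space with coordinatewise addition modulo 2 and $\mathcal{E}$ is the $\sigma$-ideal on $2^\omega$ generated by closed Lebesgue measure zero sets. An uncountable set $X\subseteq 2^\omega$ is an $\mathcal{E}$-Luzin set if $X\cap F$ is countable for every $F\in\mathcal{E}$. $\mathcal{E}^*=\{X\subseteq 2^\omega:\forall E\in\mathcal{E}\ X+E\neq 2^\omega\}$, where $X+E=\{x+e:x\in X,e\in E\}$. *)

theory Defs
  imports "HOL-Probability.Probability"
begin

text \<open>
  The Cantor space is the type \<open>nat \<Rightarrow> bool\<close>. Its type-class topology is the
  product of the discrete topologies on \<open>bool\<close>.
\<close>

type_synonym cantor = "nat \<Rightarrow> bool"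

instance bool :: second_countable_topology
proof
  show "\<exists>B :: bool set set. countable B \<and> open = generate_topology B"
    by (rule exI[of _ "range (\<lambda>a. {..< a}) \<union> range (\<lambda>a. {a <..})"])
      (simp add: open_bool_def countable_finite)
qed

text \<open>Reading \<open>True\<close> as 1 and \<open>False\<close> as 0, addition modulo 2 is exclusive disjunction.\<close>

definition cantor_add :: "cantor \<Rightarrow> cantor \<Rightarrow> cantor" where
  "cantor_add x y = (\<lambda>n. x n \<noteq> y n)"

definition cantor_sumset :: "cantor set \<Rightarrow> cantor set \<Rightarrow> cantor set" where
  "cantor_sumset X E = {cantor_add x e | x e. x \<in> X \<and> e \<in> E}"

text \<open>
  Lebesgue measure on the Cantor space is the fair-coin product measure. It is not
  completed here; as its measurable sets are the Borel sets, this makes no difference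
  to which closed sets are null.
\<close>

definition cantor_measure :: "cantor measure" where
  "cantor_measure = PiM UNIV (\<lambda>_. measure_pmf (bernoulli_pmf (1/2)))"

lemma sets_cantor_measure: "sets cantor_measure = sets borel"
proof -
  have bool_borel: "sets (borel :: bool measure) = UNIV"
    using borel_open[OF Topological_Spaces.open_discrete] by blast
  have "sets cantor_measure = sets (PiM UNIV (\<lambda>_. borel :: bool measure))"
    unfolding cantor_measure_def by (rule sets_PiM_cong) (simp_all add: bool_borel)
  then show ?thesis
    by (simp add: sets_PiM_equal_borel)
qed

definition closed_null_sets :: "cantor set set" where
  "closed_null_sets = {F. closed F \<and> F \<in> null_sets cantor_measure}"

definition sigma_ideal :: "'a set set \<Rightarrow> bool" where
  "sigma_ideal I \<longleftrightarrow>
     {} \<in> I \<and>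
     (\<forall>A\<in>I. \<forall>B. B \<subseteq> A \<longrightarrow> B \<in> I) \<and>
     (\<forall>A :: nat \<Rightarrow> 'a set. range A \<subseteq> I \<longrightarrow> (\<Union>n. A n) \<in> I)"

definition generated_sigma_ideal :: "'a set set \<Rightarrow> 'a set set" where
  "generated_sigma_ideal G = \<Inter>{I. sigma_ideal I \<and> G \<subseteq> I}"

lemma sigma_ideal_generated: "sigma_ideal (generated_sigma_ideal G)"
  unfolding sigma_ideal_def generated_sigma_ideal_def by blast

definition ideal_E :: "cantor set set" where
  "ideal_E = generated_sigma_ideal closed_null_sets"

definition E_Luzin :: "cantor set \<Rightarrow> bool" where
  "E_Luzin X \<longleftrightarrow> uncountable X \<and> (\<forall>F\<in>ideal_E. countable (X \<inter> F))"

definition E_star :: "cantor set set" where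
  "E_star = {X. \<forall>E\<in>ideal_E. cantor_sumset X E \<noteq> UNIV}"

end

theory Submission
  imports Defs
begin

text \<open>
  Cover \<open>E \<in> \<E>\<close> by an increasing sequence of closed null sets \<open>F n\<close>. As \<open>n\<close> grows, the set of
  points that agree on \<open>[m, n)\<close> with some point of \<open>F k\<close> shrinks to a finite union of
  translates of \<open>F k\<close>. So there is a sequence \<open>a\<close> growing so fast that agreement on the block
  \<open>[a k, a (k + 1))\<close> with some point of \<open>F k\<close> has probability less than \<open>2 ^ -(k + 1)\<close>. Let \<open>Z\<close>
  be the set of points that vanish on all blocks with odd \<open>k\<close>. The odd blocks show
  \<open>Z + E \<in> \<E>\<close>, so that \<open>C = X \<inter> (Z + E)\<close> is countable. On the even blocks a point \<open>z \<in> Z\<close> is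
  arbitrary and can be made to avoid \<open>C + E\<close> by diagonalization. This \<open>z\<close> is not in \<open>X + E\<close>:
  if \<open>z = x + e\<close>, then \<open>x = z + e \<in> C\<close>.
\<close>

section \<open>Closed null sets in the Cantor space\<close>

lemma space_cantor_measure [simp]: "space cantor_measure = UNIV"
  by (simp add: cantor_measure_def space_PiM)

interpretation cantor: prob_space cantor_measure
  unfolding cantor_measure_def by (intro prob_space_PiM prob_space_measure_pmf)

lemma closed_sets_cantor_measure: "closed F \<Longrightarrow> F \<in> sets cantor_measure"
  by (simp add: sets_cantor_measure)

section \<open>Invariance of the measure under flipping one coordinate\<close>

definition flip :: "nat \<Rightarrow> cantor \<Rightarrow> cantor" where
  "flip m x = x(m := \<not> x m)"

lemma emeasure_fair_coin_Not:
  "emeasure (measure_pmf (bernoulli_pmf (1/2))) (Not -` A) =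
   emeasure (measure_pmf (bernoulli_pmf (1/2))) A"
proof -
  have "map_pmf Not (bernoulli_pmf (1/2)) = bernoulli_pmf (1/2)"
    unfolding bernoulli_pmf_half_conv_pmf_of_set
    by (subst map_pmf_of_set_inj) (auto simp: inj_def UNIV_bool insert_commute)
  then show ?thesis
    by (metis emeasure_map_pmf)
qed

lemma measurable_flip [measurable]: "flip m \<in> measurable cantor_measure cantor_measure"
proof -
  let ?B = "measure_pmf (bernoulli_pmf (1/2))"
  have "(\<lambda>x i. flip m x i) \<in> measurable cantor_measure (PiM UNIV (\<lambda>_. ?B))"
  proof (rule measurable_PiM_single')
    fix i
    have coord: "(\<lambda>x. x j) \<in> measurable cantor_measure ?B" for j
      unfolding cantor_measure_def by (rule measurable_component_singleton) simp
    have "(\<lambda>x. if i = m then \<not> x m else x i) \<in> measurable cantor_measure ?B"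
      using measurable_compose[OF coord, of Not ?B m] coord[of i] by (cases "i = m") simp_all
    moreover have "(\<lambda>x. flip m x i) = (\<lambda>x. if i = m then \<not> x m else x i)"
      by (simp add: flip_def fun_eq_iff)
    ultimately show "(\<lambda>x. flip m x i) \<in> measurable cantor_measure ?B"
      by simp
  qed simp
  then show ?thesis
    by (simp add: cantor_measure_def)
qed

text \<open>A product measure is determined by its values on cylinders. Taking preimages under
  \<open>flip m\<close> replaces the factor at \<open>m\<close> by its preimage under
  \<open>Not\<close>, which has the same mass for a fair coin.\<close>

lemma distr_flip: "distr cantor_measure cantor_measure (flip m) = cantor_measure"
proof -
  let ?B = "measure_pmf (bernoulli_pmf (1/2))"
  interpret product_prob_space "\<lambda>_. ?B" "UNIV :: nat set"
    by unfold_locales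
  have "distr cantor_measure cantor_measure (flip m) = PiM UNIV (\<lambda>_. ?B)"
  proof (rule PiM_eq)
    fix J :: "nat set" and F :: "nat \<Rightarrow> bool set"
    assume J: "finite J"
    let ?F' = "\<lambda>j. if j = m then Not -` F j else F j"
    have emb: "prod_emb UNIV (\<lambda>_. ?B) J (Pi\<^sub>E J G) = {x. \<forall>j\<in>J. x j \<in> G j}" for G
      by (auto simp: prod_emb_def space_PiM)
    have "flip m -` {x. \<forall>j\<in>J. x j \<in> F j} = {x. \<forall>j\<in>J. x j \<in> ?F' j}"
      by (auto simp: flip_def)
    moreover have "prod_emb UNIV (\<lambda>_. ?B) J (Pi\<^sub>E J F) \<in> sets cantor_measure"
      unfolding cantor_measure_def using J by (intro sets_PiM_I) auto
    ultimately have "emeasure (distr cantor_measure cantor_measure (flip m))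
        (prod_emb UNIV (\<lambda>_. ?B) J (Pi\<^sub>E J F)) =
      emeasure cantor_measure (prod_emb UNIV (\<lambda>_. ?B) J (Pi\<^sub>E J ?F'))"
      by (simp add: emeasure_distr emb)
    also have "\<dots> = (\<Prod>j\<in>J. emeasure ?B (?F' j))"
      unfolding cantor_measure_def using J by (intro emeasure_PiM_emb) auto
    also have "\<dots> = (\<Prod>j\<in>J. emeasure ?B (F j))"
      by (intro prod.cong refl) (simp add: emeasure_fair_coin_Not)
    finally show "emeasure (distr cantor_measure cantor_measure (flip m))
        (prod_emb UNIV (\<lambda>_. ?B) J (Pi\<^sub>E J F)) = (\<Prod>j\<in>J. emeasure ?B (F j))" .
  qed (simp add: cantor_measure_def)
  then show ?thesis
    by (simp add: cantor_measure_def)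
qed

lemma measure_flip_vimage:
  assumes "A \<in> sets cantor_measure"
  shows "measure cantor_measure (flip m -` A) = measure cantor_measure A"
  using measure_distr[OF measurable_flip assms, of m] by (simp add: distr_flip)

section \<open>Approximation of closed sets by finite unions of cylinders\<close>

definition agree_on :: "cantor set \<Rightarrow> nat \<Rightarrow> nat \<Rightarrow> cantor set" where
  "agree_on F m n = {x. \<exists>y\<in>F. \<forall>i\<in>{m..<n}. x i = y i}"

lemma agree_on_mono: "F \<subseteq> G \<Longrightarrow> agree_on F m n \<subseteq> agree_on G m n"
  unfolding agree_on_def by blast

lemma agree_on_antimono: "n \<le> n' \<Longrightarrow> agree_on F m n' \<subseteq> agree_on F m n"
proof
  fix x assume "n \<le> n'" "x \<in> agree_on F m n'"
  then obtain y where "y \<in> F" "\<forall>i\<in>{m..<n'}. x i = y i"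
    unfolding agree_on_def by blast
  moreover from this(2) have "\<forall>i\<in>{m..<n}. x i = y i"
    using ivl_subset[of m n m n'] \<open>n \<le> n'\<close> by blast
  ultimately show "x \<in> agree_on F m n"
    unfolding agree_on_def by blast
qed

text \<open>Only finitely many patterns occur on the block \<open>{m..<n}\<close>, and each of them
  prescribes a closed cylinder.\<close>

lemma closed_agree_on: "closed (agree_on F m n)"
proof -
  \<comment> \<open>\<open>r y\<close> keeps \<open>y\<close> on the block and is
    \<open>False\<close> elsewhere, so it is coded by a subset of \<open>{m..<n}\<close>.\<close>
  define r where "r = (\<lambda>(y :: cantor) i. i \<in> {m..<n} \<and> y i)"
  have "r ` F \<subseteq> (\<lambda>S i. i \<in> S) ` Pow {m..<n}"
  proof (rule image_subsetI)
    fix y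
    show "r y \<in> (\<lambda>S i. i \<in> S) ` Pow {m..<n}"
      by (rule image_eqI[of _ _ "{i\<in>{m..<n}. y i}"]) (auto simp: r_def)
  qed
  then have "finite (r ` F)"
    by (rule finite_subset) simp
  moreover have "closed {x :: cantor. \<forall>i\<in>{m..<n}. x i = s i}" for s
  proof -
    have "closed ((\<lambda>x :: cantor. x i) -` {s i})" for i
      by (rule closed_vimage) (auto simp: closed_def open_discrete)
    then have "closed (\<Inter>i\<in>{m..<n}. (\<lambda>x :: cantor. x i) -` {s i})"
      by blast
    moreover have "(\<Inter>i\<in>{m..<n}. (\<lambda>x :: cantor. x i) -` {s i}) = {x. \<forall>i\<in>{m..<n}. x i = s i}"
      by auto
    ultimately show ?thesis by simp
  qed
  ultimately have "closed (\<Union>s\<in>r ` F. {x. \<forall>i\<in>{m..<n}. x i = s i})"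
    by blast
  also have "(\<Union>s\<in>r ` F. {x. \<forall>i\<in>{m..<n}. x i = s i}) = agree_on F m n"
    by (auto simp: agree_on_def r_def)
  finally show ?thesis .
qed

lemmas agree_on_sets [simp] = closed_sets_cantor_measure[OF closed_agree_on]

text \<open>A point that agrees with members of \<open>F\<close> on ever longer initial segments is
  their coordinatewise limit, hence lies in the closed set \<open>F\<close>.\<close>

lemma Inter_agree_on:
  assumes "closed F"
  shows "(\<Inter>n. agree_on F 0 n) = F"
proof (intro equalityI subsetI)
  fix x assume "x \<in> (\<Inter>n. agree_on F 0 n)"
  then have "\<forall>n. \<exists>y. y \<in> F \<and> (\<forall>i<n. x i = y i)"
    unfolding agree_on_def atLeast0LessThan by blast
  from choice[OF this] obtain y
    where y: "\<And>n. y n \<in> F" "\<And>n i. i < n \<Longrightarrow> x i = y n i"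
    by blast
  have "((\<lambda>n. y n i) \<longlongrightarrow> x i) sequentially" for i
  proof (rule tendsto_eventually, rule eventually_sequentiallyI)
    show "y n i = x i" if "Suc i \<le> n" for n
      using y(2)[of i n] that by simp
  qed
  then have "limitin (product_topology (\<lambda>_. euclidean) UNIV) y x sequentially"
    by (simp add: limitin_componentwise)
  then have "(y \<longlongrightarrow> x) sequentially"
    by (simp add: euclidean_product_topology)
  then show "x \<in> F"
    by (rule Lim_in_closed_set[OF assms _ sequentially_bot, rotated]) (simp add: y(1))
next
  fix x assume "x \<in> F"
  then show "x \<in> (\<Inter>n. agree_on F 0 n)"
    unfolding agree_on_def by blast
qed

text \<open>If \<open>y\<close> is a witness for \<open>x\<close> on the shorter block, then
  \<open>x\<close> or its flip at \<open>m\<close> also agrees with \<open>y\<close> at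
  \<open>m\<close>. Flipping preserves the measure, whence the factor 2.\<close>

lemma measure_agree_on_Suc:
  "measure cantor_measure (agree_on F (Suc m) n) \<le> 2 * measure cantor_measure (agree_on F m n)"
proof -
  let ?A = "agree_on F m n"
  have flip_sets: "flip m -` ?A \<in> sets cantor_measure"
    using measurable_sets[OF measurable_flip, of ?A m] by simp
  have "agree_on F (Suc m) n \<subseteq> ?A \<union> flip m -` ?A"
  proof
    fix x assume "x \<in> agree_on F (Suc m) n"
    then obtain y where y: "y \<in> F" "\<forall>i\<in>{Suc m..<n}. x i = y i"
      by (auto simp: agree_on_def)
    show "x \<in> ?A \<union> flip m -` ?A"
    proof (cases "x m = y m")
      case True
      then have "\<forall>i\<in>{m..<n}. x i = y i"
        using y(2) by (metis atLeastLessThan_iff not_less_eq_eq order_antisym)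
      then show ?thesis
        using y(1) by (auto simp: agree_on_def)
    next
      case False
      then have "\<forall>i\<in>{m..<n}. flip m x i = y i"
        using y(2) by (auto simp: flip_def)
      then show ?thesis
        using y(1) by (auto simp: agree_on_def)
    qed
  qed
  then have "measure cantor_measure (agree_on F (Suc m) n) \<le>
      measure cantor_measure (?A \<union> flip m -` ?A)"
    using flip_sets by (intro cantor.finite_measure_mono) auto
  also have "\<dots> \<le> measure cantor_measure ?A + measure cantor_measure (flip m -` ?A)"
    using flip_sets by (intro measure_Un_le) auto
  finally show ?thesis
    by (simp add: measure_flip_vimage)
qed

text \<open>For \<open>m = 0\<close> this is continuity from above along a decreasing sequence with
  intersection \<open>F\<close>. Raising \<open>m\<close> by one costs a factor 2, which a limit of
  0 absorbs.\<close>

lemma measure_agree_on_tendsto_0: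
  assumes "F \<in> closed_null_sets"
  shows "(\<lambda>n. measure cantor_measure (agree_on F m n)) \<longlonglongrightarrow> 0"
proof (induction m)
  case 0
  have "closed F" "measure cantor_measure F = 0"
    using assms by (auto simp: closed_null_sets_def measure_eq_0_null_sets)
  moreover have "decseq (\<lambda>n. agree_on F 0 n)"
    by (intro antimonoI agree_on_antimono)
  then have "(\<lambda>n. measure cantor_measure (agree_on F 0 n)) \<longlonglongrightarrow>
      measure cantor_measure (\<Inter>n. agree_on F 0 n)"
    by (intro cantor.finite_Lim_measure_decseq) auto
  ultimately show ?case
    by (simp add: Inter_agree_on)
next
  case (Suc m)
  show ?case
    by (rule tendsto_sandwich[OF _ _ tendsto_const tendsto_mult_right_zero[OF Suc, of 2]])
      (auto simp: measure_agree_on_Suc)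
qed

section \<open>The sigma-ideal generated by the closed null sets\<close>

lemma ideal_E_covered:
  assumes "E \<in> ideal_E"
  obtains F :: "nat \<Rightarrow> cantor set"
  where "incseq F" "\<And>n. F n \<in> closed_null_sets" "E \<subseteq> (\<Union>n. F n)"
proof -
  \<comment> \<open>\<open>I\<close> is a sigma-ideal that contains the generators, so it contains
    \<open>ideal_E\<close>.\<close>
  define I where
    "I = {A. \<exists>F :: nat \<Rightarrow> cantor set. range F \<subseteq> closed_null_sets \<and> A \<subseteq> (\<Union>n. F n)}"
  have "(\<Union>n. A n) \<in> I" if A: "range A \<subseteq> I" for A :: "nat \<Rightarrow> cantor set"
  proof -
    have "\<forall>n. \<exists>F :: nat \<Rightarrow> cantor set. range F \<subseteq> closed_null_sets \<and> A n \<subseteq> (\<Union>k. F k)"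
      using A by (auto simp: I_def)
    then obtain F :: "nat \<Rightarrow> nat \<Rightarrow> cantor set"
      where F: "\<And>n. range (F n) \<subseteq> closed_null_sets" "\<And>n. A n \<subseteq> (\<Union>k. F n k)"
      by metis
    have "(\<Union>n. A n) \<subseteq> (\<Union>i. case_prod F (prod_decode i))"
    proof
      fix x assume "x \<in> (\<Union>n. A n)"
      then obtain n k where "x \<in> F n k"
        using F(2) by blast
      then have "x \<in> case_prod F (prod_decode (prod_encode (n, k)))"
        by simp
      then show "x \<in> (\<Union>i. case_prod F (prod_decode i))"
        by (rule UN_I[OF UNIV_I])
    qed
    moreover have "range (\<lambda>i. case_prod F (prod_decode i)) \<subseteq> closed_null_sets"
      using F(1) by (auto simp: case_prod_beta image_subset_iff)
    ultimately show ?thesis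
      unfolding I_def by (intro CollectI exI[of _ "\<lambda>i. case_prod F (prod_decode i)"] conjI)
  qed
  moreover have "{} \<in> closed_null_sets"
    by (simp add: closed_null_sets_def)
  then have "{} \<in> I"
    unfolding I_def by (intro CollectI exI[of _ "\<lambda>_. {}"]) auto
  moreover have "B \<in> I" if "A \<in> I" "B \<subseteq> A" for A B
    using that unfolding I_def by fast
  ultimately have "sigma_ideal I"
    unfolding sigma_ideal_def by blast
  moreover have "closed_null_sets \<subseteq> I"
  proof
    fix A assume "A \<in> closed_null_sets"
    then show "A \<in> I"
      unfolding I_def by (intro CollectI exI[of _ "\<lambda>_. A"]) auto
  qed
  ultimately have "E \<in> I"
    using assms unfolding ideal_E_def generated_sigma_ideal_def by blast
  then obtain F :: "nat \<Rightarrow> cantor set"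
    where F: "range F \<subseteq> closed_null_sets" "E \<subseteq> (\<Union>n. F n)"
    by (auto simp: I_def)
  show ?thesis
  \<comment> \<open>Partial unions make the cover increasing; being finite, they remain
    closed.\<close>
  proof (rule that[of "\<lambda>n. \<Union>i\<le>n. F i"])
    show "incseq (\<lambda>n. \<Union>i\<le>n. F i)"
      by (force intro: incseq_SucI)
    show "(\<Union>i\<le>n. F i) \<in> closed_null_sets" for n
      using F(1) by (auto simp: closed_null_sets_def intro!: null_sets_UN')
    show "E \<subseteq> (\<Union>n. \<Union>i\<le>n. F i)"
      using F(2) by blast
  qed
qed

lemma closed_null_sets_UN_ideal_E:
  fixes G :: "nat \<Rightarrow> cantor set"
  assumes "\<And>n. G n \<in> closed_null_sets"
  shows "(\<Union>n. G n) \<in> ideal_E"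
proof -
  have "range G \<subseteq> ideal_E"
    using assms unfolding ideal_E_def generated_sigma_ideal_def by blast
  then show ?thesis
    using sigma_ideal_generated[of closed_null_sets]
    unfolding ideal_E_def sigma_ideal_def by simp
qed

section \<open>Translating a closed null cover off a Luzin set\<close>

text \<open>Recursive choice: once \<open>a k\<close> is fixed, the measures tend to 0 as the right
  end of the block grows, so a suitable \<open>a (Suc k)\<close> beyond \<open>a k\<close>
  exists.\<close>

lemma fast_sequence:
  fixes F :: "nat \<Rightarrow> cantor set"
  assumes "\<And>n. F n \<in> closed_null_sets"
  shows "\<exists>a :: nat \<Rightarrow> nat. strict_mono a \<and>
    (\<forall>k. measure cantor_measure (agree_on (F k) (a k) (a (Suc k))) < (1/2) ^ Suc k)"
proof -
  have "\<exists>n. m < n \<and> measure cantor_measure (agree_on (F k) m n) < (1/2) ^ Suc k" for m k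
  proof -
    have "eventually (\<lambda>n. measure cantor_measure (agree_on (F k) m n) < (1/2) ^ Suc k) sequentially"
      using measure_agree_on_tendsto_0[OF assms] by (rule order_tendstoD) simp
    then have "eventually (\<lambda>n. m < n \<and>
        measure cantor_measure (agree_on (F k) m n) < (1/2) ^ Suc k) sequentially"
      using eventually_gt_at_top[of m] by eventually_elim auto
    then show ?thesis
      by (auto dest: eventually_happens)
  qed
  then have "\<exists>a. \<forall>k. a k < a (Suc k) \<and>
      measure cantor_measure (agree_on (F k) (a k) (a (Suc k))) < (1/2) ^ Suc k"
    using dependent_nat_choice[of "\<lambda>_ _. True" "\<lambda>k m n. m < n \<and>
        measure cantor_measure (agree_on (F k) m n) < (1/2) ^ Suc k"]
    by auto
  then show ?thesis
    by (auto simp: strict_mono_Suc_iff)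
qed

text \<open>Each single block bounds the whole intersection: for \<open>k \<ge> n\<close>
  monotonicity puts \<open>F n\<close> inside \<open>F (2*k + 1)\<close>, so the block with index
  \<open>2*k + 1\<close> gives the bound \<open>(1/2) ^ k\<close>, and \<open>k\<close> can be
  arbitrarily large.\<close>

lemma Inter_agree_on_closed_null:
  assumes F: "\<And>n. F n \<in> closed_null_sets" "incseq F"
    and a: "\<And>k. measure cantor_measure (agree_on (F k) (a k) (a (Suc k))) < (1/2) ^ Suc k"
  shows "(\<Inter>k\<in>{n..}. agree_on (F n) (a (2*k + 1)) (a (2*k + 2))) \<in> closed_null_sets"
    (is "?G \<in> _")
proof -
  have "closed ?G"
    by (auto intro: closed_agree_on)
  have le: "measure cantor_measure ?G \<le> (1/2) ^ k" if "n \<le> k" for k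
  proof -
    have "?G \<subseteq> agree_on (F n) (a (2*k + 1)) (a (2*k + 2))"
      by (rule INF_lower) (use that in simp)
    also have "\<dots> \<subseteq> agree_on (F (2*k + 1)) (a (2*k + 1)) (a (2*k + 2))"
      by (rule agree_on_mono, rule incseqD[OF F(2)]) (use that in simp)
    finally have "measure cantor_measure ?G \<le>
        measure cantor_measure (agree_on (F (2*k + 1)) (a (2*k + 1)) (a (2*k + 2)))"
      by (intro cantor.finite_measure_mono) auto
    also have "\<dots> \<le> (1/2) ^ Suc (2*k + 1)"
      using a[of "2*k + 1"] by simp
    also have "\<dots> \<le> (1/2) ^ k"
      by (rule power_decreasing) auto
    finally show ?thesis .
  qed
  have "(\<lambda>k. (1/2 :: real) ^ k) \<longlonglongrightarrow> 0"
    by (rule LIMSEQ_realpow_zero) auto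
  then have "measure cantor_measure ?G \<le> 0"
    by (rule LIMSEQ_le_const) (use le in blast)
  then have "?G \<in> null_sets cantor_measure"
    using \<open>closed ?G\<close>
    by (intro null_setsI closed_sets_cantor_measure)
       (simp add: cantor.emeasure_eq_measure measure_le_0_iff)
  with \<open>closed ?G\<close> show ?thesis
    by (simp add: closed_null_sets_def)
qed

theorem theorem5p6:
  fixes X :: "(nat \<Rightarrow> bool) set"
  assumes "E_Luzin X"
  shows "X \<in> E_star"
  unfolding E_star_def
proof (intro CollectI ballI)
  fix E assume "E \<in> ideal_E"
  from ideal_E_covered[OF this] obtain F :: "nat \<Rightarrow> cantor set"
    where F: "incseq F" "\<And>n. F n \<in> closed_null_sets" "E \<subseteq> (\<Union>n. F n)"
    by blast
  obtain a :: "nat \<Rightarrow> nat" where mono_a: "strict_mono a"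
    and a: "\<And>k. measure cantor_measure (agree_on (F k) (a k) (a (Suc k))) < (1/2) ^ Suc k"
    using fast_sequence[of F] F(2) by blast
  \<comment> \<open>\<open>G n\<close> contains \<open>z + e\<close> whenever
    \<open>e \<in> F n\<close> and \<open>z\<close> vanishes on the odd blocks. Starting at
    \<open>k = n\<close> makes the estimates for \<open>F (2*k + 1)\<close> apply to
    \<open>F n\<close>.\<close>
  define G where "G = (\<lambda>n. \<Inter>k\<in>{n..}. agree_on (F n) (a (2*k + 1)) (a (2*k + 2)))"
  define C where "C = X \<inter> (\<Union>n. G n)"
  have "(\<Union>n. G n) \<in> ideal_E"
    unfolding G_def using F a by (intro closed_null_sets_UN_ideal_E Inter_agree_on_closed_null)
  then have "countable C"
    using assms by (simp add: C_def E_Luzin_def)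
  \<comment> \<open>Every element of \<open>C\<close> is listed infinitely often, hence also at stages beyond any given \<open>n\<close>.\<close>
  define c where "c = (\<lambda>k. from_nat_into C (fst (prod_decode k)))"
  \<comment> \<open>The whole space has measure 1, which exceeds the bound. Hence on each even block
    some pattern \<open>w k\<close> is matched by no point of \<open>F (2*k)\<close>.\<close>
  have "agree_on (F k) (a k) (a (Suc k)) \<noteq> UNIV" for k
  proof
    assume "agree_on (F k) (a k) (a (Suc k)) = UNIV"
    then have "1 < (1/2 :: real) ^ Suc k"
      using a[of k] cantor.prob_space by simp
    moreover have "(1/2 :: real) ^ Suc k \<le> 1"
      by (rule power_le_one) auto
    ultimately show False by simp
  qed
  then have "\<forall>k. \<exists>w. w \<notin> agree_on (F (2*k)) (a (2*k)) (a (2*k + 1))"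
    by (metis Suc_eq_plus1 UNIV_eq_I)
  from choice[OF this] obtain w
    where w: "\<And>k. w k \<notin> agree_on (F (2*k)) (a (2*k)) (a (2*k + 1))"
    by blast
  \<comment> \<open>Modulo 2, \<open>z = w k + c k\<close> on the block with index
    \<open>2*k\<close>, so that \<open>z + c k = w k\<close> there; outside the even blocks
    \<open>z\<close> is 0.\<close>
  define z :: cantor where
    "z = (\<lambda>i. \<exists>k. i \<in> {a (2*k)..<a (2*k + 1)} \<and> w k i \<noteq> c k i)"
  \<comment> \<open>This makes the \<open>k\<close> in the definition of \<open>z\<close> unique at
    each coordinate: each of the two blocks starts before the other ends.\<close>
  have same_block: "j = k" if "i \<in> {a j..<a (j + 1)}" "i \<in> {a k..<a (k + 1)}" for i j k
  proof -
    have "a j < a (k + 1)" "a k < a (j + 1)"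
      using that by auto
    then show ?thesis
      using strict_mono_less[OF mono_a] by auto
  qed
  have z_even: "z i \<longleftrightarrow> w k i \<noteq> c k i" if "i \<in> {a (2*k)..<a (2*k + 1)}" for i k
  proof -
    have "j = k" if "i \<in> {a (2*j)..<a (2*j + 1)}" for j
      using same_block[of i "2*j" "2*k"] that \<open>i \<in> {a (2*k)..<a (2*k + 1)}\<close> by simp
    with that show ?thesis
      unfolding z_def by fast
  qed
  have z_odd: "\<not> z i" if "i \<in> {a (2*k + 1)..<a (2*k + 2)}" for i k
  proof
    assume "z i"
    then obtain j where "i \<in> {a (2*j)..<a (2*j + 1)}"
      unfolding z_def by blast
    then have "2*j = 2*k + 1"
      by (rule same_block) (use that in simp)
    then show False by presburger
  qed
  have "z \<notin> cantor_sumset X E"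
  proof
    assume "z \<in> cantor_sumset X E"
    then obtain x e where xe: "z = cantor_add x e" "x \<in> X" "e \<in> E"
      by (auto simp: cantor_sumset_def)
    then obtain n where n: "e \<in> F n"
      using F(3) by blast
    \<comment> \<open>Since \<open>z = x + e\<close> vanishes on the odd blocks, \<open>x\<close>
      and \<open>e\<close> coincide there, and \<open>e\<close> witnesses
      \<open>x \<in> G n\<close>.\<close>
    have "\<forall>i\<in>{a (2*k + 1)..<a (2*k + 2)}. x i = e i" for k
      using z_odd[of _ k] by (auto simp: xe(1) cantor_add_def)
    then have "x \<in> G n"
      using n unfolding G_def agree_on_def by blast
    then have "x \<in> C"
      using xe(2) by (auto simp: C_def)
    then obtain m where m: "from_nat_into C m = x"
      using from_nat_into_surj[OF \<open>countable C\<close>] by blast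
    \<comment> \<open>The code of the pair is at least \<open>n\<close>, which puts \<open>e\<close>
      into \<open>F (2*k)\<close>, while its first component \<open>m\<close> makes
      \<open>c k\<close> equal to \<open>x\<close>.\<close>
    define k where "k = prod_encode (m, n)"
    have "n \<le> 2*k" "c k = x"
      using m le_prod_encode_2[of n m] by (auto simp: k_def c_def)
    then have "e \<in> F (2*k)"
      using n incseqD[OF F(1)] by blast
    \<comment> \<open>On this block \<open>e = z + x = z + c k = w k\<close>, so \<open>e\<close>
      would match the pattern chosen to be avoided by \<open>F (2*k)\<close>.\<close>
    moreover have "\<forall>i\<in>{a (2*k)..<a (2*k + 1)}. w k i = e i"
    proof
      fix i assume "i \<in> {a (2*k)..<a (2*k + 1)}"
      from z_even[OF this] show "w k i = e i"
        using \<open>c k = x\<close> by (simp add: xe(1) cantor_add_def) argo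
    qed
    ultimately have "w k \<in> agree_on (F (2*k)) (a (2*k)) (a (2*k + 1))"
      unfolding agree_on_def by blast
    then show False
      using w by blast
  qed
  then show "cantor_sumset X E \<noteq> UNIV"
    by blast
qed

end
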